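(* Suppose that $\mathfrak{A}=\prod_{n=1}^\infty\mathfrak{A}_n$ and $\mathfrak{B}=\prod_{n=1}^\infty\mathfrak{B}_n$ with $\mathfrak{A}_n,\mathfrak{B}_n\subset\mathfrak{D}_n$, and that $\{\psi_n\}$ strongly separates $\mathfrak{A}$ from $\mathfrak{B}$. For two sequences of statistics $\{\xi_n\}$ and $\{\eta_n\}$ valued in $\mathfrak{D}^*=\mathfrak{A}\cup\mathfrak{B}$, if $\psi_n(\xi_n,\mathbb{X}_n)\leqslant\psi_n(\eta_n,\mathbb{X}_n)$ for all $n$, then $$\liminf_{n\to\infty}\left[P(\xi_n\in\mathfrak{A}_n)-P(\eta_n\in\mathfrak{A}_n)\right]\geqslant0$$ and $$P\big(\{\xi_n\}\in\mathfrak{A}\big)\geqslant P\big(\{\eta_n\}\in\mathfrak{A}\big).$$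
   Context: Let $(\Omega,\mathfrak{F},P)$ be a probability space. All sets and maps are assumed measurable. For each $n\in\mathbb{N}$, the sample $\mathbb{X}_n$ is a map from $\Omega$ to a space $\mathcal{X}_n$, $\mathfrak{D}_n$ is a set (the decision space at sample size $n$), and the objective function $\psi_n$ is a map from $\mathfrak{D}_n\times\mathcal{X}_n$ to $\mathbb{R}$. Put $\mathfrak{D}=\prod_{n=1}^\infty\mathfrak{D}_n$; $\mathfrak{A},\mathfrak{B}$ are subsets of $\mathfrak{D}$ and $\mathfrak{D}^*=\mathfrak{A}\cup\mathfrak{B}$. A sequence of statistics $\{\xi_n\}$ valued in $\mathfrak{D}^*$ means that each $\xi_n$ is a measurable function of $\mathbb{X}_n$ valued in $\mathfrak{D}_n$ and the sequence $\{\xi_n(\omega)\}_{n\geq1}$ belongs to $\mathfrak{D}^*$ for every $\omega\in\Omega$. When $\mathfrak{A}=\prod_n\mathfrak{A}_n$ and $\mathfrak{B}=\prod_n\mathfrak{B}_n$, we say that $\{\psi_n\}$ strongly separates $\mathfrak{A}$ from $\mathfrak{B}$ if, as $n\to\infty$, $P\left(\sup_{x\in\mathfrak{A}_n}\psi_n(x,\mathbb{X}_n)<\inf_{y\in\mathfrak{B}_n}\psi_n(y,\mathbb{X}_n)\right)\to1$. *)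

theory Defs
  imports "HOL-Probability.Probability"
begin

text \<open>
  Sample size \<open>n\<close> ranges over \<open>{1..}\<close>. The sample space and the decision space at sample size
  \<open>n\<close> are the measurable spaces \<open>S n\<close> and \<open>D n\<close> (only \<open>space\<close> and \<open>sets\<close> of these
  measures matter), carried by arbitrary types common to all \<open>n\<close>; values at \<open>n = 0\<close> are
  never used. A sequence indexed by \<open>n \<ge> 1\<close> is a function extensional on \<open>{1..}\<close>, so that
  infinite products are \<open>PiE {1..}\<close>.
\<close>

definition seq_of ::
  "(nat \<Rightarrow> 'w \<Rightarrow> 'd) \<Rightarrow> 'w \<Rightarrow> nat \<Rightarrow> 'd"
  where "seq_of \<xi> \<omega> = restrict (\<lambda>n. \<xi> n \<omega>) {1..}"

definition statistics_valued_in ::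
  "'w measure \<Rightarrow> (nat \<Rightarrow> 'x measure) \<Rightarrow> (nat \<Rightarrow> 'w \<Rightarrow> 'x) \<Rightarrow> (nat \<Rightarrow> 'd measure)
    \<Rightarrow> (nat \<Rightarrow> 'd) set \<Rightarrow> (nat \<Rightarrow> 'w \<Rightarrow> 'd) \<Rightarrow> bool"
  where "statistics_valued_in M S X D Dstar \<xi> \<longleftrightarrow>
    (\<forall>n\<ge>1. \<exists>f \<in> measurable (S n) (D n). \<forall>\<omega>\<in>space M. \<xi> n \<omega> = f (X n \<omega>)) \<and>
    (\<forall>\<omega>\<in>space M. seq_of \<xi> \<omega> \<in> Dstar)"

text \<open>
  Supremum and infimum are taken in the extended reals: they may be infinite, with
  \<open>-\<infinity>\<close> and \<open>\<infinity>\<close> as the supremum and infimum of the empty set.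
\<close>

definition separation_event ::
  "'w measure \<Rightarrow> (nat \<Rightarrow> 'w \<Rightarrow> 'x) \<Rightarrow> (nat \<Rightarrow> 'd \<times> 'x \<Rightarrow> real)
    \<Rightarrow> (nat \<Rightarrow> 'd set) \<Rightarrow> (nat \<Rightarrow> 'd set) \<Rightarrow> nat \<Rightarrow> 'w set"
  where "separation_event M X \<psi> A B n =
    {\<omega> \<in> space M. (SUP x\<in>A n. ereal (\<psi> n (x, X n \<omega>))) < (INF y\<in>B n. ereal (\<psi> n (y, X n \<omega>)))}"

text \<open>
  The separation events involve possibly uncountable suprema, so their measurability does not
  follow from that of \<open>\<psi>\<close> and \<open>X\<close> and is required explicitly. The arguments \<open>A\<close> and \<open>B\<close>
  are the families of factors of the two products.
\<close>

definition strongly_separates ::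
  "'w measure \<Rightarrow> (nat \<Rightarrow> 'w \<Rightarrow> 'x) \<Rightarrow> (nat \<Rightarrow> 'd \<times> 'x \<Rightarrow> real)
    \<Rightarrow> (nat \<Rightarrow> 'd set) \<Rightarrow> (nat \<Rightarrow> 'd set) \<Rightarrow> bool"
  where "strongly_separates M X \<psi> A B \<longleftrightarrow>
    (\<forall>n\<ge>1. separation_event M X \<psi> A B n \<in> sets M) \<and>
    (\<lambda>n. measure M (separation_event M X \<psi> A B n)) \<longlonglongrightarrow> 1"

end

theory Submission imports Defs begin

text \<open>
  The separation event at \<open>n\<close> forbids a swap: there, every point of \<open>B n\<close> has a
  strictly larger objective value than every point of \<open>A n\<close>. Since \<open>\<xi>\<close> never has a larger value
  than \<open>\<eta>\<close>, it cannot happen on this event that \<open>\<eta> n\<close> is in \<open>A n\<close> while \<open>\<xi> n\<close> is in \<open>B n\<close>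
  (lemma \<open>no_swap_on_separation_event\<close>).

  Both inequalities compare an event \<open>E\<close> about \<open>\<eta>\<close> with the same event \<open>F\<close> about \<open>\<xi>\<close>, and in
  both cases \<open>E\<close> without \<open>F\<close> forces a swap. So \<open>P(E) - P(F)\<close> is at most the probability that
  separation fails (lemma \<open>prob_le_up_to_complement\<close>). For the first inequality, \<open>E\<close> and \<open>F\<close>
  depend on \<open>n\<close>, and the bound tends to 0. For the second one, a sequence that is valued in the
  union of the two products and is not in the first product lies in the second one as a whole, so
  the swap occurs at every \<open>n\<close> at once. Then the bound holds for fixed \<open>E\<close> and \<open>F\<close> with every
  \<open>n\<close>, and its limit gives \<open>P(E) \<le> P(F)\<close>.
\<close>

lemma (in prob_space) prob_le_up_to_complement:
  assumes E: "E \<in> events" and F: "F \<in> events" and G: "G \<in> events"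
    and sub: "E \<inter> G \<subseteq> F"
  shows "prob G - 1 \<le> prob F - prob E"
proof -
  have "prob E \<le> prob (F \<union> (space M - G))"
    using sub sets.sets_into_space[OF E] F G by (intro finite_measure_mono) auto
  also have "\<dots> \<le> prob F + prob (space M - G)"
    using F G by (intro measure_Un_le) auto
  finally show ?thesis
    using prob_compl[OF G] by simp
qed

lemma no_swap_on_separation_event:
  assumes sep: "\<omega> \<in> separation_event M X \<psi> A B n"
    and "y \<in> A n" and "x \<in> B n"
  shows "\<psi> n (y, X n \<omega>) < \<psi> n (x, X n \<omega>)"
proof -
  have "ereal (\<psi> n (y, X n \<omega>)) \<le> (SUP x\<in>A n. ereal (\<psi> n (x, X n \<omega>)))"
    using assms(2) by (rule SUP_upper)
  also have "\<dots> < (INF y\<in>B n. ereal (\<psi> n (y, X n \<omega>)))"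
    using sep by (simp add: separation_event_def)
  also have "\<dots> \<le> ereal (\<psi> n (x, X n \<omega>))"
    using assms(3) by (rule INF_lower)
  finally show ?thesis by simp
qed

lemma seq_of_mem_PiE_iff: "seq_of \<xi> \<omega> \<in> PiE {1..} A \<longleftrightarrow> (\<forall>n\<ge>1. \<xi> n \<omega> \<in> A n)"
  by (auto simp: seq_of_def PiE_iff)

lemma statistics_valued_in_event:
  assumes "statistics_valued_in M S X D Dstar \<xi>"
    and "n \<ge> 1" and X: "X n \<in> measurable M (S n)" and A: "A n \<in> sets (D n)"
  shows "{\<omega> \<in> space M. \<xi> n \<omega> \<in> A n} \<in> sets M"
proof -
  obtain f where f: "f \<in> measurable (S n) (D n)" and eq: "\<forall>\<omega>\<in>space M. \<xi> n \<omega> = f (X n \<omega>)"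
    using assms(1,2) unfolding statistics_valued_in_def by blast
  have "(\<lambda>\<omega>. f (X n \<omega>)) -` A n \<inter> space M \<in> sets M"
    using measurable_compose[OF X f] A by (rule measurable_sets)
  also have "(\<lambda>\<omega>. f (X n \<omega>)) -` A n \<inter> space M = {\<omega> \<in> space M. \<xi> n \<omega> \<in> A n}"
    using eq by auto
  finally show ?thesis .
qed

lemma statistics_valued_in_product_event:
  assumes "statistics_valued_in M S X D Dstar \<xi>"
    and "\<And>n. n \<ge> 1 \<Longrightarrow> X n \<in> measurable M (S n)" and "\<And>n. n \<ge> 1 \<Longrightarrow> A n \<in> sets (D n)"
  shows "{\<omega> \<in> space M. seq_of \<xi> \<omega> \<in> PiE {1..} A} \<in> sets M"
proof -
  have "(\<Inter>n\<in>{1..}. {\<omega> \<in> space M. \<xi> n \<omega> \<in> A n}) \<in> sets M"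
    using statistics_valued_in_event[OF assms(1)] assms(2,3)
    by (intro sets.countable_INT') auto
  also have "(\<Inter>n\<in>{1..}. {\<omega> \<in> space M. \<xi> n \<omega> \<in> A n})
      = {\<omega> \<in> space M. seq_of \<xi> \<omega> \<in> PiE {1..} A}"
    unfolding seq_of_mem_PiE_iff by auto
  finally show ?thesis .
qed

theorem theorem3p4:
  fixes M :: "'w measure"
    and S :: "nat \<Rightarrow> 'x measure"
    and X :: "nat \<Rightarrow> 'w \<Rightarrow> 'x"
    and D :: "nat \<Rightarrow> 'd measure"
    and \<psi> :: "nat \<Rightarrow> 'd \<times> 'x \<Rightarrow> real"
    and A B :: "nat \<Rightarrow> 'd set"
    and \<AA> \<BB> :: "(nat \<Rightarrow> 'd) set"
    and \<xi> \<eta> :: "nat \<Rightarrow> 'w \<Rightarrow> 'd"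
  assumes "prob_space M"
    and "\<And>n. n \<ge> 1 \<Longrightarrow> X n \<in> measurable M (S n)"
    and "\<And>n. n \<ge> 1 \<Longrightarrow> \<psi> n \<in> borel_measurable (D n \<Otimes>\<^sub>M S n)"
    and "\<And>n. n \<ge> 1 \<Longrightarrow> A n \<in> sets (D n)"
    and "\<And>n. n \<ge> 1 \<Longrightarrow> B n \<in> sets (D n)"
    and "\<AA> = PiE {1..} A"
    and "\<BB> = PiE {1..} B"
    and "strongly_separates M X \<psi> A B"
    and "statistics_valued_in M S X D (\<AA> \<union> \<BB>) \<xi>"
    and "statistics_valued_in M S X D (\<AA> \<union> \<BB>) \<eta>"
    and "\<And>n \<omega>. n \<ge> 1 \<Longrightarrow> \<omega> \<in> space M \<Longrightarrow> \<psi> n (\<xi> n \<omega>, X n \<omega>) \<le> \<psi> n (\<eta> n \<omega>, X n \<omega>)"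
  shows "liminf (\<lambda>n. ereal (measure M {\<omega> \<in> space M. \<xi> n \<omega> \<in> A n}
                          - measure M {\<omega> \<in> space M. \<eta> n \<omega> \<in> A n})) \<ge> 0
    \<and> measure M {\<omega> \<in> space M. seq_of \<xi> \<omega> \<in> \<AA>} \<ge> measure M {\<omega> \<in> space M. seq_of \<eta> \<omega> \<in> \<AA>}"
proof -
  interpret prob_space M by fact
  note X = assms(2) and A = assms(4) and \<AA> = assms(6) and \<BB> = assms(7)
    and stat_\<xi> = assms(9) and stat_\<eta> = assms(10) and le = assms(11)
  define G where "G = separation_event M X \<psi> A B"
  have G: "G n \<in> events" if "n \<ge> 1" for n
    using assms(8) that by (simp add: strongly_separates_def G_def)
  have "(\<lambda>n. prob (G n)) \<longlonglongrightarrow> 1"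
    using assms(8) by (simp add: strongly_separates_def G_def)
  from tendsto_diff[OF this tendsto_const[of 1]]
  have G_lim: "(\<lambda>n. prob (G n) - 1) \<longlonglongrightarrow> 0" by simp

  have no_swap: "\<not> (\<eta> n \<omega> \<in> A n \<and> \<xi> n \<omega> \<in> B n)" if "n \<ge> 1" "\<omega> \<in> space M" "\<omega> \<in> G n" for n \<omega>
    using no_swap_on_separation_event[of \<omega> M X \<psi> A B n "\<eta> n \<omega>" "\<xi> n \<omega>"] le[OF that(1,2)] that(3)
    by (auto simp: G_def)
  have \<xi>_cases: "(\<forall>n\<ge>1. \<xi> n \<omega> \<in> A n) \<or> (\<forall>n\<ge>1. \<xi> n \<omega> \<in> B n)" if "\<omega> \<in> space M" for \<omega>
    using stat_\<xi> that unfolding statistics_valued_in_def \<AA> \<BB> Un_iff seq_of_mem_PiE_iff by blast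

  have bound: "prob (G n) - 1
      \<le> prob {\<omega> \<in> space M. \<xi> n \<omega> \<in> A n} - prob {\<omega> \<in> space M. \<eta> n \<omega> \<in> A n}" if n: "n \<ge> 1" for n
  proof (rule prob_le_up_to_complement)
    show "{\<omega> \<in> space M. \<eta> n \<omega> \<in> A n} \<inter> G n \<subseteq> {\<omega> \<in> space M. \<xi> n \<omega> \<in> A n}"
      using no_swap[OF n] \<xi>_cases n by blast
  qed (use statistics_valued_in_event[where X = X and A = A, OF stat_\<xi> n X[OF n] A[OF n]]
        statistics_valued_in_event[where X = X and A = A, OF stat_\<eta> n X[OF n] A[OF n]] G[OF n] in auto)
  have "0 = liminf (\<lambda>n. ereal (prob (G n) - 1))"
    using G_lim by (intro lim_imp_Liminf[symmetric]) (simp_all add: zero_ereal_def)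
  also have "\<dots> \<le> liminf (\<lambda>n. ereal (prob {\<omega> \<in> space M. \<xi> n \<omega> \<in> A n}
      - prob {\<omega> \<in> space M. \<eta> n \<omega> \<in> A n}))"
    by (intro Liminf_mono eventually_sequentiallyI[of 1]) (use bound in simp)
  finally have pointwise: "liminf (\<lambda>n. ereal (prob {\<omega> \<in> space M. \<xi> n \<omega> \<in> A n}
      - prob {\<omega> \<in> space M. \<eta> n \<omega> \<in> A n})) \<ge> 0" .

  have bound_seq: "prob (G n) - 1
      \<le> prob {\<omega> \<in> space M. seq_of \<xi> \<omega> \<in> \<AA>} - prob {\<omega> \<in> space M. seq_of \<eta> \<omega> \<in> \<AA>}"
    if n: "n \<ge> 1" for n
  proof (rule prob_le_up_to_complement)
    \<comment> \<open>Separation at the single index \<open>n\<close> is enough: \<open>\<xi>\<close> outside the first product would have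
      its \<open>n\<close>-th term in \<open>B n\<close>.\<close>
    show "{\<omega> \<in> space M. seq_of \<eta> \<omega> \<in> \<AA>} \<inter> G n \<subseteq> {\<omega> \<in> space M. seq_of \<xi> \<omega> \<in> \<AA>}"
      unfolding \<AA> seq_of_mem_PiE_iff using no_swap[OF n] \<xi>_cases n by blast
  qed (use statistics_valued_in_product_event[OF stat_\<xi> X A]
        statistics_valued_in_product_event[OF stat_\<eta> X A] G[OF n] in \<open>auto simp: \<AA>\<close>)
  have "0 \<le> prob {\<omega> \<in> space M. seq_of \<xi> \<omega> \<in> \<AA>} - prob {\<omega> \<in> space M. seq_of \<eta> \<omega> \<in> \<AA>}"
    using G_lim bound_seq by (intro LIMSEQ_le_const2) blast+
  with pointwise show ?thesis by simp
qed

end
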